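(* Let $f_1,\dots,f_k,h_1,\dots,h_s\in\mathbb{R}[x_1,\dots,x_n]$ and consider the multiobjective polynomial binary program $$\min\ (f_1(x),\dots,f_k(x))\quad\text{s.t.}\quad h_r(x)=0\ (r=1,\dots,s),\quad x\in\{0,1\}^n .$$ Let $G$ be the reduced Gröbner basis of the ideal $$I=\langle f_1-y_1,\dots,f_k-y_k,\ h_1,\dots,h_s,\ x_1(x_1-1),\dots,x_n(x_n-1)\rangle\subset\mathbb{R}[y_1,\dots,y_k,x_1,\dots,x_n]$$ with respect to the lexicographic order with $y_k\prec\cdots\prec y_1\prec x_n\prec\cdots\prec x_1$. Then the elimination algorithm described in the context either provides all nondominated and efficient solutions of the program or provides a certificate of infeasibility whenever $G=\{1\}$. That is: (i) if $G\neq\{1\}$, then the sets computed by the algorithm in its Steps 3 and 4 are, respectively, exactly the set $Y_E$ of all efficient solutions and exactly the set $X_E$ of all nondominated solutions of the program; (ii) if $G=\{1\}$, then the program is infeasible.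
   Context: A point $x\in\{0,1\}^n$ with $h_r(x)=0$ for all $r$ is called feasible. A feasible $x$ is dominated by a feasible $x'$ if $f_i(x')\le f_i(x)$ for all $i=1,\dots,k$ and $(f_1(x'),\dots,f_k(x'))\ne(f_1(x),\dots,f_k(x))$. A feasible point is nondominated if no feasible point dominates it; $X_E\subset\mathbb{R}^n$ is the set of all nondominated solutions. The vectors $(f_1(x),\dots,f_k(x))$ with $x\in X_E$ are called efficient solutions, and $Y_E\subset\mathbb{R}^k$ is the set of all of them. $V(\cdot)$ denotes the set of common zeros of a set of polynomials, in the affine space of the variables of the polynomial ring under consideration. The algorithm: Step 1. Compute $G$. Step 2. For $l=0,\dots,k-1$ let $G^y_l=G\cap\mathbb{R}[y_{l+1},\dots,y_k]$. Find all $\hat y_k\in V(G^y_{k-1})$; extend each of them in all possible ways to $(\hat y_{k-1},\hat y_k)\in V(G^y_{k-2})$; continue in this way, adding one coordinate at a time, until all points $(\hat y_1,\dots,\hat y_k)\in V(G^y_0)$ are found. Step 3. Select the vectors of $V(G^y_0)$ that are minimal for the componentwise partial order on $\mathbb{R}^k$. The resulting set is output as the set of efficient solutions; call it $Y$. Step 4. For $l=0,\dots,n-1$ let $G_l=G\cap\mathbb{R}[y_1,\dots,y_k,x_{l+1},\dots,x_n]$, and let $S_l$ be the set of $(\hat y_1,\dots,\hat y_k,\hat x_{l+1},\dots,\hat x_n)$ such that $(\hat y_1,\dots,\hat y_k)\in Y$ and there exist $x_1,\dots,x_l$ with $(x_1,\dots,x_l,\hat x_{l+1},\dots,\hat x_n)$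 feasible. Find all $(\hat y,\hat x_n)\in V(G_{n-1})\cap S_{n-1}$, extend them in all possible ways to points $(\hat y,\hat x_{n-1},\hat x_n)\in V(G_{n-2})\cap S_{n-2}$, and so on, one coordinate at a time, until all points of $V(G_0)\cap S_0$ are found. Output $\pi_x(V(G_0)\cap S_0)$ as the set of nondominated solutions, where $\pi_x$ is the projection onto the $x$-variables. *)

theory Defs
  imports Complex_Main "HOL-Library.Poly_Mapping" "HOL-Library.FuncSet" "HOL-Algebra.Ideal"
begin

section \<open>Variables and the lexicographic order\<close>

text \<open>
  The variables \<open>x\<^sub>j\<close> and \<open>y\<^sub>i\<close> are \<open>Xv j\<close> and \<open>Yv i\<close>, with indices starting at 1.
  They are linearly ordered as \<open>x\<^sub>1, x\<^sub>2, \<dots>, y\<^sub>1, y\<^sub>2, \<dots>\<close>. The library order on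
  \<open>'a \<Rightarrow>\<^sub>0 nat\<close> compares two monomials at the \<^emph>\<open>least\<close> index where they differ, so on monomials
  it is the lexicographic order with
  \<open>y\<^sub>k \<prec> \<dots> \<prec> y\<^sub>1 \<prec> x\<^sub>n \<prec> \<dots> \<prec> x\<^sub>1\<close>; see the two lemmas below.
\<close>

datatype var = Xv nat | Yv nat

instantiation var :: linorder
begin

fun less_var :: "var \<Rightarrow> var \<Rightarrow> bool" where
  "less_var (Xv i) (Xv j) \<longleftrightarrow> i < j"
| "less_var (Xv i) (Yv j) \<longleftrightarrow> True"
| "less_var (Yv i) (Xv j) \<longleftrightarrow> False"
| "less_var (Yv i) (Yv j) \<longleftrightarrow> i < j"

definition less_eq_var :: "var \<Rightarrow> var \<Rightarrow> bool" where
  "less_eq_var v w \<longleftrightarrow> v < w \<or> v = w"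

instance
proof
  fix u v w :: var
  show "v < w \<longleftrightarrow> v \<le> w \<and> \<not> w \<le> v"
    by (cases v; cases w) (auto simp: less_eq_var_def)
  show "v \<le> v"
    by (simp add: less_eq_var_def)
  show "u \<le> v \<Longrightarrow> v \<le> w \<Longrightarrow> u \<le> w"
    by (cases u; cases v; cases w) (auto simp: less_eq_var_def)
  show "v \<le> w \<Longrightarrow> w \<le> v \<Longrightarrow> v = w"
    by (cases v; cases w) (auto simp: less_eq_var_def)
  show "v \<le> w \<or> w \<le> v"
    by (cases v; cases w) (auto simp: less_eq_var_def)
qed

end

type_synonym monomial = "var \<Rightarrow>\<^sub>0 nat"
type_synonym mpoly = "monomial \<Rightarrow>\<^sub>0 real"

lemma monomial_less_iff_lex:
  fixes m m' :: monomial
  shows "m < m' \<longleftrightarrow>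
    (\<exists>v. Poly_Mapping.lookup m v < Poly_Mapping.lookup m' v \<and>
         (\<forall>w<v. Poly_Mapping.lookup m w = Poly_Mapping.lookup m' w))"
  by transfer (auto simp: less_fun_def)

lemma variable_precedence:
  fixes i j :: nat
  shows "i < j \<Longrightarrow> Poly_Mapping.single (Yv j) (1::nat) < Poly_Mapping.single (Yv i) 1"
    and "Poly_Mapping.single (Yv i) (1::nat) < Poly_Mapping.single (Xv j) 1"
    and "i < j \<Longrightarrow> Poly_Mapping.single (Xv j) (1::nat) < Poly_Mapping.single (Xv i) 1"
  unfolding monomial_less_iff_lex
  by (rule exI[of _ "Yv i"] exI[of _ "Xv j"] exI[of _ "Xv i"],
      auto simp: lookup_single when_def)+


section \<open>Polynomials in a given set of variables\<close>

definition PVar :: "var \<Rightarrow> mpoly" where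
  "PVar v = Poly_Mapping.single (Poly_Mapping.single v 1) 1"

definition poly_ring :: "var set \<Rightarrow> mpoly ring" where
  "poly_ring W =
    \<lparr>carrier = {p. \<forall>m\<in>Poly_Mapping.keys p. Poly_Mapping.keys m \<subseteq> W},
     mult = (*), one = 1, zero = 0, add = (+)\<rparr>"

definition eval :: "(var \<Rightarrow> real) \<Rightarrow> mpoly \<Rightarrow> real" where
  "eval a p = (\<Sum>m\<in>Poly_Mapping.keys p. Poly_Mapping.lookup p m *
     (\<Prod>v\<in>Poly_Mapping.keys m. a v ^ Poly_Mapping.lookup m v))"

text \<open>
  A point of the affine space with coordinates indexed by \<open>W\<close> is an element of
  \<open>W \<rightarrow>\<^sub>E UNIV\<close>, i.e. a function that is \<open>undefined\<close> outside \<open>W\<close>.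
\<close>

definition zeros :: "var set \<Rightarrow> mpoly set \<Rightarrow> (var \<Rightarrow> real) set" where
  "zeros W B = {a \<in> W \<rightarrow>\<^sub>E UNIV. \<forall>p\<in>B. eval a p = 0}"

definition xvars :: "nat \<Rightarrow> nat \<Rightarrow> var set" where
  "xvars l n = Xv ` {l<..n}"

definition yvars :: "nat \<Rightarrow> nat \<Rightarrow> var set" where
  "yvars l k = Yv ` {l<..k}"


section \<open>Reduced Groebner bases\<close>

definition lead_monomial :: "mpoly \<Rightarrow> monomial" where
  "lead_monomial p = Max (Poly_Mapping.keys p)"

definition lead_coefficient :: "mpoly \<Rightarrow> real" where
  "lead_coefficient p = Poly_Mapping.lookup p (lead_monomial p)"

definition lead_term :: "mpoly \<Rightarrow> mpoly" where
  "lead_term p = Poly_Mapping.single (lead_monomial p) (lead_coefficient p)"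

definition groebner_basis :: "var set \<Rightarrow> mpoly set \<Rightarrow> mpoly set \<Rightarrow> bool" where
  "groebner_basis W I G \<longleftrightarrow> finite G \<and> G \<subseteq> I \<and>
    Idl\<^bsub>poly_ring W\<^esub> (lead_term ` G) = Idl\<^bsub>poly_ring W\<^esub> (lead_term ` (I - {0}))"

definition reduced_groebner_basis :: "var set \<Rightarrow> mpoly set \<Rightarrow> mpoly set \<Rightarrow> bool" where
  "reduced_groebner_basis W I G \<longleftrightarrow> groebner_basis W I G \<and>
    (\<forall>p\<in>G. lead_coefficient p = 1 \<and>
      (\<forall>m\<in>Poly_Mapping.keys p.
        Poly_Mapping.single m 1 \<notin> Idl\<^bsub>poly_ring W\<^esub> (lead_term ` (G - {p}))))"


section \<open>The multiobjective binary program\<close>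

definition feasible :: "nat \<Rightarrow> nat \<Rightarrow> (nat \<Rightarrow> mpoly) \<Rightarrow> (var \<Rightarrow> real) \<Rightarrow> bool" where
  "feasible n s h x \<longleftrightarrow> x \<in> xvars 0 n \<rightarrow>\<^sub>E {0, 1} \<and> (\<forall>r\<in>{1..s}. eval x (h r) = 0)"

text \<open>The vector \<open>(f\<^sub>1(x), \<dots>, f\<^sub>k(x))\<close>, whose \<open>i\<close>-th coordinate is indexed by \<open>y\<^sub>i\<close>:\<close>

definition objective :: "nat \<Rightarrow> (nat \<Rightarrow> mpoly) \<Rightarrow> (var \<Rightarrow> real) \<Rightarrow> (var \<Rightarrow> real)" where
  "objective k f x = (\<lambda>v\<in>yvars 0 k. case v of Yv i \<Rightarrow> eval x (f i) | Xv j \<Rightarrow> undefined)"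

definition dominated_by ::
  "nat \<Rightarrow> (nat \<Rightarrow> mpoly) \<Rightarrow> (var \<Rightarrow> real) \<Rightarrow> (var \<Rightarrow> real) \<Rightarrow> bool" where
  "dominated_by k f x x' \<longleftrightarrow>
    (\<forall>i\<in>{1..k}. eval x' (f i) \<le> eval x (f i)) \<and> objective k f x' \<noteq> objective k f x"

definition nondominated_set ::
  "nat \<Rightarrow> nat \<Rightarrow> nat \<Rightarrow> (nat \<Rightarrow> mpoly) \<Rightarrow> (nat \<Rightarrow> mpoly) \<Rightarrow> (var \<Rightarrow> real) set" where
  "nondominated_set k n s f h =
    {x. feasible n s h x \<and> \<not> (\<exists>x'. feasible n s h x' \<and> dominated_by k f x x')}"

definition efficient_set ::
  "nat \<Rightarrow> nat \<Rightarrow> nat \<Rightarrow> (nat \<Rightarrow> mpoly) \<Rightarrow> (nat \<Rightarrow> mpoly) \<Rightarrow> (var \<Rightarrow> real) set" where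
  "efficient_set k n s f h = objective k f ` nondominated_set k n s f h"

definition program_ideal ::
  "nat \<Rightarrow> nat \<Rightarrow> nat \<Rightarrow> (nat \<Rightarrow> mpoly) \<Rightarrow> (nat \<Rightarrow> mpoly) \<Rightarrow> mpoly set" where
  "program_ideal k n s f h = Idl\<^bsub>poly_ring (yvars 0 k \<union> xvars 0 n)\<^esub>
    ((\<lambda>i. f i - PVar (Yv i)) ` {1..k} \<union> h ` {1..s} \<union>
     (\<lambda>j. PVar (Xv j) * (PVar (Xv j) - 1)) ` {1..n})"


section \<open>The elimination algorithm\<close>

text \<open>
  \<open>sweep W C N j\<close> is the set of partial points found after \<open>j\<close> coordinates have been added. \<open>W l\<close> is
  the set of coordinates present at level \<open>l\<close> and \<open>C l\<close> the set of points admitted there; the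
  levels are visited in the order \<open>N - 1, N - 2, \<dots>, 0\<close>. Before the first extension the
  coordinates in \<open>W N\<close> are unconstrained, so \<open>sweep W C N 1 = C (N - 1)\<close> if \<open>N > 0\<close>,
  \<open>W N \<subseteq> W (N - 1)\<close> and \<open>C (N - 1) \<subseteq> W (N - 1) \<rightarrow>\<^sub>E UNIV\<close>.
\<close>

primrec sweep ::
  "(nat \<Rightarrow> var set) \<Rightarrow> (nat \<Rightarrow> (var \<Rightarrow> real) set) \<Rightarrow> nat \<Rightarrow> nat \<Rightarrow> (var \<Rightarrow> real) set" where
  "sweep W C N 0 = W N \<rightarrow>\<^sub>E UNIV"
| "sweep W C N (Suc j) =
    (\<Union>a\<in>sweep W C N j. {b \<in> C (N - Suc j). restrict b (W (N - j)) = a})"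

definition step2 :: "nat \<Rightarrow> mpoly set \<Rightarrow> (var \<Rightarrow> real) set" where
  "step2 k G = sweep (\<lambda>l. yvars l k)
     (\<lambda>l. zeros (yvars l k) (G \<inter> carrier (poly_ring (yvars l k)))) k k"

definition step3 :: "nat \<Rightarrow> mpoly set \<Rightarrow> (var \<Rightarrow> real) set" where
  "step3 k G = {y \<in> step2 k G.
     \<not> (\<exists>z\<in>step2 k G. (\<forall>i\<in>{1..k}. z (Yv i) \<le> y (Yv i)) \<and> z \<noteq> y)}"

definition step4_admissible ::
  "nat \<Rightarrow> nat \<Rightarrow> nat \<Rightarrow> (nat \<Rightarrow> mpoly) \<Rightarrow> (var \<Rightarrow> real) set \<Rightarrow> nat \<Rightarrow> (var \<Rightarrow> real) set" where
  "step4_admissible k n s h Y l = {a \<in> (yvars 0 k \<union> xvars l n) \<rightarrow>\<^sub>E UNIV.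
     restrict a (yvars 0 k) \<in> Y \<and>
     (\<exists>x. feasible n s h x \<and> (\<forall>v\<in>xvars l n. x v = a v))}"

definition step4 ::
  "nat \<Rightarrow> nat \<Rightarrow> nat \<Rightarrow> (nat \<Rightarrow> mpoly) \<Rightarrow> mpoly set \<Rightarrow> (var \<Rightarrow> real) set" where
  "step4 k n s h G = (\<lambda>a. restrict a (xvars 0 n)) `
     sweep (\<lambda>l. yvars 0 k \<union> xvars l n)
       (\<lambda>l. zeros (yvars 0 k \<union> xvars l n)
               (G \<inter> carrier (poly_ring (yvars 0 k \<union> xvars l n))) \<inter>
             step4_admissible k n s h (step3 k G) l) n n"

end

theory Submission
  imports Defs
begin

text \<open>
  Every feasible point is binary, so by interpolation \<open>I\<close> contains all polynomials that vanish on the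
  finite set of points \<open>(f(x), x)\<close> with \<open>x\<close> feasible. In particular \<open>1 \<in> I\<close> iff the program is
  infeasible, and for a point \<open>y\<close> outside the finite set of values \<open>f(x)\<close> a product of factors
  \<open>y\<^sub>i - c\<close> is an element of \<open>I\<close> in the \<open>y\<close>-variables alone that does not vanish at \<open>y\<close>. Division by
  a lexicographic Groebner basis carries this over from \<open>I\<close> to \<open>G\<close>: the common zeros of the
  \<open>y\<close>-polynomials in \<open>G\<close> are exactly the values \<open>f(x)\<close>, and those of \<open>G\<close> are exactly the points
  \<open>(f(x), x)\<close>. Since the constraints only grow from level to level, the coordinatewise sweeps
  compute these two zero sets (in Step 4 restricted to efficient \<open>y\<close>).
\<close>

section \<open>Polynomials and evaluation\<close>

lemma carrier_poly_ring_iff: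
  "p \<in> carrier (poly_ring W) \<longleftrightarrow> (\<forall>m\<in>Poly_Mapping.keys p. Poly_Mapping.keys m \<subseteq> W)"
  by (simp add: poly_ring_def)

lemma keys_subset_vars:
  "p \<in> carrier (poly_ring W) \<Longrightarrow> m \<in> Poly_Mapping.keys p \<Longrightarrow> Poly_Mapping.keys m \<subseteq> W"
  by (simp add: carrier_poly_ring_iff)

lemma poly_ring_sel [simp]:
  "monoid.mult (poly_ring W) = (*)" "monoid.one (poly_ring W) = 1"
  "ring.zero (poly_ring W) = 0" "ring.add (poly_ring W) = (+)"
  by (simp_all add: poly_ring_def)

lemma carrier_poly_ring_mono: "W \<subseteq> W' \<Longrightarrow> carrier (poly_ring W) \<subseteq> carrier (poly_ring W')"
  unfolding subset_iff carrier_poly_ring_iff by blast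

lemma carrier_single: "Poly_Mapping.keys m \<subseteq> W \<Longrightarrow> Poly_Mapping.single m c \<in> carrier (poly_ring W)"
  by (auto simp: carrier_poly_ring_iff split: if_splits)

lemma carrier_PVar: "v \<in> W \<Longrightarrow> PVar v \<in> carrier (poly_ring W)"
  by (simp add: PVar_def carrier_single)

lemma carrier_0: "0 \<in> carrier (poly_ring W)"
  and carrier_1: "1 \<in> carrier (poly_ring W)"
  by (auto simp: carrier_poly_ring_iff)

lemma carrier_add:
  "p \<in> carrier (poly_ring W) \<Longrightarrow> q \<in> carrier (poly_ring W) \<Longrightarrow> p + q \<in> carrier (poly_ring W)"
  using keys_add[of p q] by (auto simp: carrier_poly_ring_iff)

lemma carrier_uminus: "p \<in> carrier (poly_ring W) \<Longrightarrow> - p \<in> carrier (poly_ring W)"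
  by (auto simp: carrier_poly_ring_iff in_keys_iff)

lemma carrier_diff:
  "p \<in> carrier (poly_ring W) \<Longrightarrow> q \<in> carrier (poly_ring W) \<Longrightarrow> p - q \<in> carrier (poly_ring W)"
  using carrier_add[of p W "- q"] carrier_uminus[of q W] by simp

lemma keys_add_nat: "Poly_Mapping.keys (m + m' :: 'a \<Rightarrow>\<^sub>0 nat) = Poly_Mapping.keys m \<union> Poly_Mapping.keys m'"
  by (auto simp: in_keys_iff lookup_add)

lemma carrier_mult:
  "p \<in> carrier (poly_ring W) \<Longrightarrow> q \<in> carrier (poly_ring W) \<Longrightarrow> p * q \<in> carrier (poly_ring W)"
  using keys_mult[of p q] by (fastforce simp: carrier_poly_ring_iff keys_add_nat)

lemmas carrier_intros = carrier_single carrier_PVar carrier_0 carrier_1 carrier_add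
  carrier_uminus carrier_diff carrier_mult

lemma carrier_prod:
  "(\<And>i. i \<in> A \<Longrightarrow> p i \<in> carrier (poly_ring W)) \<Longrightarrow> prod p A \<in> carrier (poly_ring W)"
  by (induction A rule: infinite_finite_induct) (auto intro: carrier_intros)

lemma cring_poly_ring: "cring (poly_ring W)"
proof (rule cringI)
  show "abelian_group (poly_ring W)"
  proof (rule abelian_groupI)
    show "\<exists>q\<in>carrier (poly_ring W). q \<oplus>\<^bsub>poly_ring W\<^esub> p = \<zero>\<^bsub>poly_ring W\<^esub>"
      if "p \<in> carrier (poly_ring W)" for p
      by (rule bexI[of _ "- p"]) (simp_all add: that carrier_uminus)
  qed (simp_all add: add_ac carrier_intros)
  show "comm_monoid (poly_ring W)"
    by (rule comm_monoidI) (auto simp: algebra_simps intro: carrier_intros)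
qed (simp add: algebra_simps)

lemma ring_poly_ring: "ring (poly_ring W)"
  using cring_poly_ring by (rule cring.axioms)

lemma sum_single_lookup:
  "p = (\<Sum>m\<in>Poly_Mapping.keys p. Poly_Mapping.single m (Poly_Mapping.lookup p m))"
  by (rule poly_mapping_eqI) (auto simp: lookup_sum lookup_single when_def in_keys_iff)

text \<open>Constants and variables generate the ring: products of variables give monomials, scaling
  gives terms, and sums of terms give polynomials. The carrier facts in \<open>add\<close> and
  \<open>mult\<close> let inductions use absorption by an ideal.\<close>

lemma poly_ring_induct [consumes 1, case_names const var add mult]:
  assumes "p \<in> carrier (poly_ring W)"
    and const: "\<And>c. P (Poly_Mapping.single 0 c)"
    and var: "\<And>v. v \<in> W \<Longrightarrow> P (PVar v)"
    and add: "\<And>p q. p \<in> carrier (poly_ring W) \<Longrightarrow> q \<in> carrier (poly_ring W) \<Longrightarrow> P p \<Longrightarrow> P q \<Longrightarrow> P (p + q)"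
    and mult: "\<And>p q. p \<in> carrier (poly_ring W) \<Longrightarrow> q \<in> carrier (poly_ring W) \<Longrightarrow> P p \<Longrightarrow> P q \<Longrightarrow> P (p * q)"
  shows "P p"
proof -
  define M where "M m \<longleftrightarrow> Poly_Mapping.keys m \<subseteq> W \<and> P (Poly_Mapping.single m 1)" for m :: monomial
  have M0: "M 0"
    using const[of 1] by (simp add: M_def)
  have Madd: "M (m + m')" if "M m" "M m'" for m m'
    using that mult[of "Poly_Mapping.single m 1" "Poly_Mapping.single m' 1"]
    by (auto simp: M_def mult_single keys_add_nat intro: carrier_intros)
  have Mpow: "M (Poly_Mapping.single v e)" if "v \<in> W" for v e
  proof (induction e)
    case (Suc e)
    have "M (Poly_Mapping.single v 1)"
      using that var[of v] by (simp add: M_def PVar_def)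
    then have "M (Poly_Mapping.single v 1 + Poly_Mapping.single v e)"
      using Suc by (rule Madd)
    then show ?case
      by (simp flip: single_add)
  qed (simp add: M0)
  have Msum: "M (sum g A)" if "\<And>v. v \<in> A \<Longrightarrow> M (g v)" for g and A :: "var set"
    using that by (induction A rule: infinite_finite_induct) (auto simp: M0 Madd)
  \<comment> \<open>A monomial is itself a finitely supported map, so
    \<open>sum_single_lookup\<close> also splits it into powers of single variables.\<close>
  have M: "M m" if "Poly_Mapping.keys m \<subseteq> W" for m
    by (subst sum_single_lookup) (use that Mpow in \<open>auto intro!: Msum\<close>)
  have single: "P (Poly_Mapping.single m c)" if "Poly_Mapping.keys m \<subseteq> W" for m c
    using mult[of "Poly_Mapping.single 0 c" "Poly_Mapping.single m 1"] const M[OF that]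
    by (simp add: mult_single M_def carrier_single that)
  have "sum g A \<in> carrier (poly_ring W) \<and> P (sum g A)"
    if "\<And>m. m \<in> A \<Longrightarrow> g m \<in> carrier (poly_ring W) \<and> P (g m)" for g and A :: "monomial set"
    using that
    by (induction A rule: infinite_finite_induct)
       (use const[of 0] in \<open>auto intro: carrier_intros add\<close>)
  then show ?thesis
    by (subst sum_single_lookup)
       (use assms(1) single in \<open>auto simp: carrier_poly_ring_iff intro: carrier_intros\<close>)
qed

section \<open>Evaluation as a ring homomorphism\<close>

definition eval_monomial :: "(var \<Rightarrow> real) \<Rightarrow> monomial \<Rightarrow> real" where
  "eval_monomial a m = (\<Prod>v\<in>Poly_Mapping.keys m. a v ^ Poly_Mapping.lookup m v)"

lemma eval_monomial_add: "eval_monomial a (m + m') = eval_monomial a m * eval_monomial a m'"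
proof -
  have superset: "eval_monomial a m = (\<Prod>v\<in>S. a v ^ Poly_Mapping.lookup m v)"
    if "finite S" "Poly_Mapping.keys m \<subseteq> S" for m S
    unfolding eval_monomial_def
    by (rule prod.mono_neutral_left) (use that in \<open>auto simp: in_keys_iff\<close>)
  define S where "S = Poly_Mapping.keys m \<union> Poly_Mapping.keys m'"
  have "finite S"
    by (simp add: S_def)
  then show ?thesis
    by (simp add: superset[of S] S_def keys_add_nat lookup_add power_add prod.distrib)
qed

lemma eval_superset:
  assumes "finite S" "Poly_Mapping.keys p \<subseteq> S"
  shows "eval a p = (\<Sum>m\<in>S. Poly_Mapping.lookup p m * eval_monomial a m)"
  unfolding eval_def eval_monomial_def
  by (rule sum.mono_neutral_left) (use assms in \<open>auto simp: in_keys_iff\<close>)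

lemma eval_add: "eval a (p + q) = eval a p + eval a q"
proof -
  define S where "S = Poly_Mapping.keys p \<union> Poly_Mapping.keys q"
  have "finite S" "Poly_Mapping.keys (p + q) \<subseteq> S"
    using keys_add[of p q] by (simp_all add: S_def)
  then show ?thesis
    by (simp add: eval_superset[of S] S_def lookup_add distrib_right sum.distrib)
qed

lemma eval_single: "eval a (Poly_Mapping.single m c) = c * eval_monomial a m"
  by (simp add: eval_superset[of "{m}"])

lemma eval_const: "eval a (Poly_Mapping.single 0 c) = c"
  by (simp add: eval_single eval_monomial_def)

lemma eval_0: "eval a 0 = 0"
  by (simp add: eval_def)

lemma eval_1: "eval a 1 = 1"
  using eval_const[of a 1] by simp

lemma eval_PVar: "eval a (PVar v) = a v"
  by (simp add: PVar_def eval_single eval_monomial_def)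

lemma eval_sum: "eval a (sum p A) = (\<Sum>i\<in>A. eval a (p i))"
  by (induction A rule: infinite_finite_induct) (auto simp: eval_0 eval_add)

lemma eval_uminus: "eval a (- p) = - eval a p"
  using eval_add[of a p "- p"] by (simp add: eval_0)

lemma eval_diff: "eval a (p - q) = eval a p - eval a q"
  using eval_add[of a p "- q"] by (simp add: eval_uminus)

lemma eval_mult: "eval a (p * q) = eval a p * eval a q"
proof -
  have "eval a (p * q) = eval a ((\<Sum>m\<in>Poly_Mapping.keys p. Poly_Mapping.single m (Poly_Mapping.lookup p m))
    * (\<Sum>m\<in>Poly_Mapping.keys q. Poly_Mapping.single m (Poly_Mapping.lookup q m)))"
    by (simp flip: sum_single_lookup)
  also have "\<dots> = (\<Sum>m\<in>Poly_Mapping.keys p. \<Sum>m'\<in>Poly_Mapping.keys q.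
      (Poly_Mapping.lookup p m * eval_monomial a m) * (Poly_Mapping.lookup q m' * eval_monomial a m'))"
    by (simp add: sum_product eval_sum mult_single eval_single eval_monomial_add mult_ac)
  also have "\<dots> = eval a p * eval a q"
    by (simp add: sum_product eval_superset[OF _ order_refl])
  finally show ?thesis .
qed

lemma eval_prod: "eval a (prod p A) = (\<Prod>i\<in>A. eval a (p i))"
  by (induction A rule: infinite_finite_induct) (auto simp: eval_1 eval_mult)

lemmas eval_simps = eval_0 eval_1 eval_const eval_PVar eval_add eval_uminus eval_diff eval_mult

text \<open>Allows passing between a point, its restrictions and its extensions by further
  coordinates.\<close>

lemma eval_cong:
  assumes "p \<in> carrier (poly_ring W)" and "\<And>v. v \<in> W \<Longrightarrow> a v = b v"
  shows "eval a p = eval b p"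
  using assms(1) by (induction p rule: poly_ring_induct) (auto simp: eval_simps assms(2))

section \<open>Ideals\<close>

text \<open>Closure under additive inverses follows from multiplication by \<open>- 1\<close>, so it
  is not among the premises.\<close>

lemma ideal_poly_ringI:
  assumes "J \<subseteq> carrier (poly_ring W)" "0 \<in> J" "\<And>p q. p \<in> J \<Longrightarrow> q \<in> J \<Longrightarrow> p + q \<in> J"
    "\<And>p q. p \<in> carrier (poly_ring W) \<Longrightarrow> q \<in> J \<Longrightarrow> p * q \<in> J"
  shows "ideal J (poly_ring W)"
proof (rule idealI[OF ring_poly_ring])
  have inv: "inv\<^bsub>add_monoid (poly_ring W)\<^esub> p = - p" if "p \<in> carrier (poly_ring W)" for p
  proof -
    interpret cring "poly_ring W" by (rule cring_poly_ring)
    show ?thesis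
      using minus_equality[of "- p" p] that by (simp add: carrier_uminus a_inv_def)
  qed
  have "- p \<in> J" if "p \<in> J" for p
    using assms(4)[of "- 1" p] that by (simp add: carrier_intros)
  then show "subgroup J (add_monoid (poly_ring W))"
    by (intro subgroup.intro) (use assms inv in auto)
  show "a \<otimes>\<^bsub>poly_ring W\<^esub> x \<in> J" if "a \<in> J" "x \<in> carrier (poly_ring W)" for a x
    using assms(4)[OF that(2,1)] by (simp add: mult.commute)
qed (use assms(4) in simp)

locale poly_ideal =
  fixes W :: "var set" and I :: "mpoly set"
  assumes is_ideal: "ideal I (poly_ring W)"
begin

lemma subset_carrier: "I \<subseteq> carrier (poly_ring W)"
  using ideal.Icarr[OF is_ideal] by blast

lemma zero_mem: "0 \<in> I"
  using additive_subgroup.zero_closed[OF ideal.axioms(1)[OF is_ideal]] by simp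

lemma add_mem: "p \<in> I \<Longrightarrow> q \<in> I \<Longrightarrow> p + q \<in> I"
  using additive_subgroup.a_closed[OF ideal.axioms(1)[OF is_ideal]] by simp

lemma mult_mem: "p \<in> carrier (poly_ring W) \<Longrightarrow> q \<in> I \<Longrightarrow> p * q \<in> I"
  using ideal.I_l_closed[OF is_ideal] by simp

lemma uminus_mem: "p \<in> I \<Longrightarrow> - p \<in> I"
  using mult_mem[of "- 1" p] by (simp add: carrier_intros)

lemma diff_mem: "p \<in> I \<Longrightarrow> q \<in> I \<Longrightarrow> p - q \<in> I"
  using add_mem[of p "- q"] uminus_mem by simp

lemma sum_mem: "(\<And>i. i \<in> A \<Longrightarrow> p i \<in> I) \<Longrightarrow> sum p A \<in> I"
  by (induction A rule: infinite_finite_induct) (auto simp: zero_mem add_mem)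

end

lemma poly_ideal_Idl: "S \<subseteq> carrier (poly_ring W) \<Longrightarrow> poly_ideal W (Idl\<^bsub>poly_ring W\<^esub> S)"
  using ring.genideal_ideal[OF ring_poly_ring] by (simp add: poly_ideal_def)

lemma Idl_superset: "S \<subseteq> Idl\<^bsub>poly_ring W\<^esub> S"
  by (auto simp: genideal_def)

text \<open>The polynomials vanishing at \<open>a\<close> form an ideal, and the generated ideal is
  the least one containing \<open>S\<close>.\<close>

lemma eval_Idl_eq_0:
  assumes "S \<subseteq> carrier (poly_ring W)" "\<And>p. p \<in> S \<Longrightarrow> eval a p = 0" "p \<in> Idl\<^bsub>poly_ring W\<^esub> S"
  shows "eval a p = 0"
proof -
  have "ideal {p \<in> carrier (poly_ring W). eval a p = 0} (poly_ring W)"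
    by (rule ideal_poly_ringI) (auto simp: eval_simps intro: carrier_intros)
  from ring.genideal_minimal[OF ring_poly_ring this, of S] assms show ?thesis
    by blast
qed

section \<open>Groebner bases and elimination\<close>

lemma lead_monomial_in_keys: "p \<noteq> 0 \<Longrightarrow> lead_monomial p \<in> Poly_Mapping.keys p"
  unfolding lead_monomial_def by (rule Max_in) auto

lemma le_lead_monomial: "m \<in> Poly_Mapping.keys p \<Longrightarrow> m \<le> lead_monomial p"
  unfolding lead_monomial_def by (rule Max_ge) auto

lemma lead_coefficient_eq_0_iff: "lead_coefficient p = 0 \<longleftrightarrow> p = 0"
  using lead_monomial_in_keys[of p] by (auto simp: lead_coefficient_def in_keys_iff)

text \<open>The polynomials all of whose monomials are divisible by some lead monomial form an ideal
  containing the lead terms. The condition \<open>g \<noteq> 0\<close> excludes the zero polynomial,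
  whose lead monomial is an unspecified \<open>Max {}\<close>.\<close>

lemma Idl_lead_term_divisible:
  assumes "G \<subseteq> carrier (poly_ring W)" "p \<in> Idl\<^bsub>poly_ring W\<^esub> (lead_term ` G)"
    "m \<in> Poly_Mapping.keys p"
  shows "\<exists>g\<in>G. g \<noteq> 0 \<and> (\<exists>u. m = u + lead_monomial g)"
proof -
  define J where "J = {p \<in> carrier (poly_ring W). \<forall>m\<in>Poly_Mapping.keys p.
    \<exists>g\<in>G. g \<noteq> 0 \<and> (\<exists>u. m = u + lead_monomial g)}"
  have "ideal J (poly_ring W)"
  proof (rule ideal_poly_ringI)
    show "p + q \<in> J" if "p \<in> J" "q \<in> J" for p q
      using that keys_add[of p q] by (auto simp: J_def intro: carrier_intros)
    show "p * q \<in> J" if p: "p \<in> carrier (poly_ring W)" and q: "q \<in> J" for p q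
      unfolding J_def
    proof (intro CollectI conjI ballI)
      show "p * q \<in> carrier (poly_ring W)"
        using p q by (auto simp: J_def intro: carrier_intros)
      fix m assume "m \<in> Poly_Mapping.keys (p * q)"
      then obtain b c where "m = b + c" "c \<in> Poly_Mapping.keys q"
        using keys_mult[of p q] by auto
      moreover from this q obtain g u where "g \<in> G" "g \<noteq> 0" "c = u + lead_monomial g"
        by (auto simp: J_def)
      ultimately have "m = (b + u) + lead_monomial g"
        by (simp add: add.assoc)
      with \<open>g \<in> G\<close> \<open>g \<noteq> 0\<close> show "\<exists>g\<in>G. g \<noteq> 0 \<and> (\<exists>u. m = u + lead_monomial g)"
        by blast
    qed
  qed (auto simp: J_def carrier_0)
  moreover have "lead_term g \<in> J" if "g \<in> G" for g
  proof (cases "g = 0")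
    case False
    then have "Poly_Mapping.keys (lead_monomial g) \<subseteq> W"
      using assms(1) that lead_monomial_in_keys[of g] by (intro keys_subset_vars[of g]) auto
    then show ?thesis
      using that False
      by (auto simp: J_def lead_term_def intro!: carrier_intros bexI[of _ g] exI[of _ 0] split: if_splits)
  qed (simp add: J_def lead_term_def lead_coefficient_def carrier_0)
  ultimately have "Idl\<^bsub>poly_ring W\<^esub> (lead_term ` G) \<subseteq> J"
    by (intro ring.genideal_minimal[OF ring_poly_ring]) auto
  with assms(2,3) show ?thesis
    by (auto simp: J_def)
qed

text \<open>The order on all monomials is not well-founded, since the variables themselves form an
  infinite descending chain. If the members of \<open>S\<close> differ only at finitely many
  variables, minimising the exponents one variable at a time, the most significant first, yields a
  least element.\<close>

lemma lex_min_exists: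
  fixes S :: "monomial set"
  assumes "finite A" "S \<noteq> {}"
    and "\<And>m m' v. m \<in> S \<Longrightarrow> m' \<in> S \<Longrightarrow> v \<notin> A \<Longrightarrow> Poly_Mapping.lookup m v = Poly_Mapping.lookup m' v"
  shows "\<exists>m\<in>S. \<forall>m'\<in>S. m \<le> m'"
  using assms
proof (induction A arbitrary: S rule: finite_linorder_min_induct)
  case empty
  have "m = m'" if "m \<in> S" "m' \<in> S" for m m'
    by (rule poly_mapping_eqI) (rule empty.prems(2)[OF that], simp)
  moreover obtain m where "m \<in> S"
    using empty.prems(1) by blast
  ultimately show ?case
    by (metis order_refl)
next
  case (insert b A)
  define c where "c = (LEAST c. \<exists>m\<in>S. Poly_Mapping.lookup m b = c)"
  define S' where "S' = {m\<in>S. Poly_Mapping.lookup m b = c}"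
  have "\<exists>m\<in>S. Poly_Mapping.lookup m b = c"
    unfolding c_def by (rule LeastI_ex) (use insert.prems in auto)
  then have "S' \<noteq> {}"
    by (auto simp: S'_def)
  moreover have "Poly_Mapping.lookup m v = Poly_Mapping.lookup m' v"
    if "m \<in> S'" "m' \<in> S'" "v \<notin> A" for m m' v
    using that insert.prems(2)[of m m' v] by (cases "v = b") (auto simp: S'_def)
  ultimately obtain m where m: "m \<in> S'" "\<forall>m'\<in>S'. m \<le> m'"
    using insert.IH[of S'] by blast
  have "m \<le> m'" if "m' \<in> S" for m'
  proof (cases "m' \<in> S'")
    case False
    have "c \<le> Poly_Mapping.lookup m' b"
      unfolding c_def by (rule Least_le) (use that in auto)
    then have "Poly_Mapping.lookup m b < Poly_Mapping.lookup m' b"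
      using m(1) False that by (auto simp: S'_def)
    \<comment> \<open>Since \<open>b\<close> is the minimum of \<open>insert b A\<close>, any
      \<open>w < b\<close> lies outside this set, where all of \<open>S\<close> agrees.\<close>
    moreover have "Poly_Mapping.lookup m w = Poly_Mapping.lookup m' w" if "w < b" for w
      using insert.prems(2)[of m m' w] insert.hyps(2) that m(1) \<open>m' \<in> S\<close> by (fastforce simp: S'_def)
    ultimately have "m < m'"
      unfolding monomial_less_iff_lex by blast
    then show ?thesis
      by simp
  qed (use m in auto)
  with m(1) show ?case
    by (auto simp: S'_def)
qed

lemma monomial_nonneg: "0 \<le> (m :: monomial)"
proof (rule ccontr)
  assume "\<not> 0 \<le> m"
  then have "m < 0"
    by simp
  then show False
    unfolding monomial_less_iff_lex by simp
qed

text \<open>The elimination property of the lexicographic order: a monomial over \<open>W\<close>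
  that involves a variable outside the final segment \<open>U\<close> exceeds every monomial over
  \<open>U\<close>, hence cannot occur below such a lead monomial.\<close>

lemma lead_monomial_elimination:
  assumes g: "g \<in> carrier (poly_ring W)" "g \<noteq> 0"
    and final: "\<And>v w. v \<in> U \<Longrightarrow> w \<in> W \<Longrightarrow> v < w \<Longrightarrow> w \<in> U"
    and lead: "Poly_Mapping.keys (lead_monomial g) \<subseteq> U"
  shows "g \<in> carrier (poly_ring U)"
  unfolding carrier_poly_ring_iff
proof (intro ballI subsetI)
  fix m v assume m: "m \<in> Poly_Mapping.keys g" and v: "v \<in> Poly_Mapping.keys m"
  \<comment> \<open>The most significant variable of \<open>m\<close>; once it lies in
    \<open>U\<close>, finality of \<open>U\<close> puts all other variables of \<open>m\<close>
    there.\<close>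
  define v0 where "v0 = Min (Poly_Mapping.keys m)"
  have v0: "v0 \<in> Poly_Mapping.keys m" "\<And>w. w \<in> Poly_Mapping.keys m \<Longrightarrow> v0 \<le> w"
    unfolding v0_def using v by (auto intro!: Min_in)
  have keys_m: "Poly_Mapping.keys m \<subseteq> W"
    using g m by (auto simp: carrier_poly_ring_iff)
  have "v0 \<in> U"
  proof (rule ccontr)
    assume "v0 \<notin> U"
    then have "Poly_Mapping.lookup (lead_monomial g) v0 < Poly_Mapping.lookup m v0"
      using lead v0(1) by (metis in_keys_iff in_mono neq0_conv)
    moreover have "Poly_Mapping.lookup (lead_monomial g) w = Poly_Mapping.lookup m w" if "w < v0" for w
    proof -
      have "w \<notin> Poly_Mapping.keys m"
        using v0(2)[of w] that by auto
      moreover have "w \<notin> Poly_Mapping.keys (lead_monomial g)"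
        using final[of w v0] \<open>v0 \<notin> U\<close> keys_m v0(1) lead that by auto
      ultimately show ?thesis
        by (simp add: in_keys_iff)
    qed
    ultimately have "lead_monomial g < m"
      unfolding monomial_less_iff_lex by blast
    with le_lead_monomial[OF m] show False
      by simp
  qed
  with final[of v0 v] v0(2)[OF v] v keys_m show "v \<in> U"
    by (cases "v = v0") auto
qed

section \<open>Division by a Groebner basis\<close>

lemma groebner_basis_subset: "groebner_basis W I G \<Longrightarrow> G \<subseteq> I"
  by (simp add: groebner_basis_def)

text \<open>Turns the equality of lead-term ideals into the divisibility that a division step
  needs.\<close>

lemma groebner_basis_lead_divisor:
  assumes "I \<subseteq> carrier (poly_ring W)" "groebner_basis W I G" "p \<in> I" "p \<noteq> 0"
  shows "\<exists>g\<in>G. g \<noteq> 0 \<and> (\<exists>u. lead_monomial p = u + lead_monomial g)"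
proof -
  have "lead_term p \<in> Idl\<^bsub>poly_ring W\<^esub> (lead_term ` (I - {0}))"
    by (rule subsetD[OF Idl_superset]) (simp add: assms(3,4))
  also have "Idl\<^bsub>poly_ring W\<^esub> (lead_term ` (I - {0})) = Idl\<^bsub>poly_ring W\<^esub> (lead_term ` G)"
    using assms(2) by (simp add: groebner_basis_def)
  finally have "lead_term p \<in> Idl\<^bsub>poly_ring W\<^esub> (lead_term ` G)" .
  moreover have "lead_monomial p \<in> Poly_Mapping.keys (lead_term p)"
    using assms(4) by (simp add: lead_term_def lead_coefficient_eq_0_iff)
  moreover have "G \<subseteq> carrier (poly_ring W)"
    using assms(1) groebner_basis_subset[OF assms(2)] by blast
  ultimately show ?thesis
    using Idl_lead_term_divisible by blast
qed

text \<open>Among the elements of \<open>I\<close> over \<open>U\<close> that do not vanish at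
  \<open>a\<close>, take one with least lead monomial. Cancelling its lead term by a multiple of
  some \<open>g\<close> in \<open>G\<close> keeps its value at \<open>a\<close>, because
  \<open>g\<close> is over \<open>U\<close> and so vanishes there; this contradicts
  minimality.\<close>

lemma groebner_elimination_zero:
  assumes I: "poly_ideal W I" and G: "groebner_basis W I G"
    and U: "finite U" "U \<subseteq> W" "\<And>v w. v \<in> U \<Longrightarrow> w \<in> W \<Longrightarrow> v < w \<Longrightarrow> w \<in> U"
    and zero: "\<And>g. g \<in> G \<Longrightarrow> g \<in> carrier (poly_ring U) \<Longrightarrow> eval a g = 0"
    and "p \<in> I" "p \<in> carrier (poly_ring U)"
  shows "eval a p = 0"
proof (rule ccontr)
  interpret poly_ideal W I by (rule I)
  assume nz: "eval a p \<noteq> 0"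
  define B where "B = {q \<in> I. q \<in> carrier (poly_ring U) \<and> eval a q \<noteq> 0}"
  have keys_B: "Poly_Mapping.keys (lead_monomial q) \<subseteq> U" if "q \<in> B" for q
  proof (rule keys_subset_vars[of q])
    have "q \<noteq> 0"
      using that by (auto simp: B_def eval_0)
    then show "lead_monomial q \<in> Poly_Mapping.keys q"
      by (rule lead_monomial_in_keys)
  qed (use that in \<open>simp add: B_def\<close>)
  have indep: "Poly_Mapping.lookup m v = Poly_Mapping.lookup m' v"
    if "m \<in> lead_monomial ` B" "m' \<in> lead_monomial ` B" "v \<notin> U" for m m' v
  proof -
    from that keys_B have "v \<notin> Poly_Mapping.keys m" "v \<notin> Poly_Mapping.keys m'"
      by auto
    then show ?thesis
      by (simp add: in_keys_iff)
  qed
  have nonempty: "lead_monomial ` B \<noteq> {}"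
    using assms(7,8) nz by (auto simp: B_def)
  obtain q where q: "q \<in> B" and min: "\<forall>q'\<in>B. lead_monomial q \<le> lead_monomial q'"
    using lex_min_exists[OF U(1) nonempty indep] by blast
  have "q \<in> I" "q \<noteq> 0" "q \<in> carrier (poly_ring U)" "eval a q \<noteq> 0"
    using q by (auto simp: B_def eval_0)
  from groebner_basis_lead_divisor[OF subset_carrier G this(1,2)]
  obtain g u where g: "g \<in> G" "g \<noteq> 0" and lead: "lead_monomial q = u + lead_monomial g"
    by blast
  have keys_u: "Poly_Mapping.keys u \<subseteq> U" and keys_g: "Poly_Mapping.keys (lead_monomial g) \<subseteq> U"
    using keys_B[OF q] by (simp_all add: lead keys_add_nat)
  have gI: "g \<in> I"
    using g(1) groebner_basis_subset[OF G] by blast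
  \<comment> \<open>The lead monomial of \<open>g\<close> divides that of \<open>q\<close> and is
    therefore over \<open>U\<close>; by elimination all of \<open>g\<close> is.\<close>
  have gU: "g \<in> carrier (poly_ring U)"
    by (rule lead_monomial_elimination[OF subsetD[OF subset_carrier gI] g(2) U(3) keys_g])
  define t where "t = Poly_Mapping.single u (lead_coefficient q / lead_coefficient g)"
  define r where "r = q - t * g"
  have "t \<in> carrier (poly_ring U)"
    using keys_u by (simp add: t_def carrier_single)
  moreover from this have "t \<in> carrier (poly_ring W)"
    by (rule subsetD[OF carrier_poly_ring_mono[OF U(2)]])
  moreover have "eval a r = eval a q"
    by (simp add: r_def eval_simps zero[OF g(1) gU])
  ultimately have "r \<in> B"
    using \<open>q \<in> I\<close> \<open>q \<in> carrier (poly_ring U)\<close> \<open>eval a q \<noteq> 0\<close> gI gU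
    by (simp add: B_def r_def carrier_diff carrier_mult diff_mem mult_mem)
  then have "r \<noteq> 0"
    by (auto simp: B_def eval_0)
  \<comment> \<open>Multiplying by the single term \<open>t\<close> shifts exponents by
    \<open>u\<close>, so only the monomial \<open>m\<close> of \<open>g\<close> contributes at
    \<open>u + m\<close>.\<close>
  have lookup_t: "Poly_Mapping.lookup (t * g) (u + m) = lead_coefficient q / lead_coefficient g * Poly_Mapping.lookup g m" for m
  proof -
    have "Poly_Mapping.lookup (t * g) (u + m) =
      (\<Sum>m'\<in>Poly_Mapping.keys g. Poly_Mapping.lookup (t * Poly_Mapping.single m' (Poly_Mapping.lookup g m')) (u + m))"
      by (subst sum_single_lookup[of g]) (simp add: sum_distrib_left lookup_sum)
    also have "\<dots> = (\<Sum>m'\<in>Poly_Mapping.keys g. if m' = m then lead_coefficient q / lead_coefficient g * Poly_Mapping.lookup g m else 0)"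
      by (rule sum.cong) (auto simp: t_def mult_single lookup_single when_def)
    also have "\<dots> = lead_coefficient q / lead_coefficient g * Poly_Mapping.lookup g m"
      by (simp add: in_keys_iff)
    finally show ?thesis .
  qed
  have "Poly_Mapping.lookup r (lead_monomial q) = 0"
    using lookup_t[of "lead_monomial g"] g(2)
    by (simp add: r_def lookup_minus lead lead_coefficient_eq_0_iff)
       (simp add: lead_coefficient_def lead lead_coefficient_eq_0_iff[unfolded lead_coefficient_def])
  moreover have "m \<le> lead_monomial q" if m: "m \<in> Poly_Mapping.keys r" for m
  proof -
    consider "m \<in> Poly_Mapping.keys q" | "m \<in> Poly_Mapping.keys (t * g)"
      using keys_diff[of q "t * g"] m by (auto simp: r_def)
    then show ?thesis
    proof cases
      case 2
      then obtain m' where "m = u + m'" "m' \<in> Poly_Mapping.keys g"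
        using keys_mult[of t g] by (auto simp: t_def split: if_splits)
      then show ?thesis
        using le_lead_monomial[of m' g] by (simp add: lead add_left_mono)
    qed (rule le_lead_monomial)
  qed
  ultimately have "lead_monomial r < lead_monomial q"
    using lead_monomial_in_keys[OF \<open>r \<noteq> 0\<close>] by (metis in_keys_iff order_le_less)
  with min \<open>r \<in> B\<close> show False
    by auto
qed

text \<open>The lead monomial of \<open>1\<close> is \<open>0\<close>, so some element of
  \<open>G\<close> has lead monomial \<open>0\<close>, the least monomial, and being monic it is
  \<open>1\<close>. Any further element would have monomials divisible by the lead term
  \<open>1\<close>, against reducedness.\<close>

lemma reduced_groebner_basis_eq_one:
  assumes I: "poly_ideal W I" and G: "reduced_groebner_basis W I G" and "1 \<in> I"
  shows "G = {1}"
proof -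
  interpret poly_ideal W I by (rule I)
  have gb: "groebner_basis W I G"
    using G by (simp add: reduced_groebner_basis_def)
  have monic: "lead_coefficient g = 1" if "g \<in> G" for g
    using G that by (simp add: reduced_groebner_basis_def)
  obtain g u where g: "g \<in> G" "g \<noteq> 0" and lead: "lead_monomial 1 = u + lead_monomial g"
    using groebner_basis_lead_divisor[OF subset_carrier gb \<open>1 \<in> I\<close>] by auto
  have "u + lead_monomial g = 0"
    using lead by (simp add: lead_monomial_def)
  then have "Poly_Mapping.keys (u + lead_monomial g) = {}"
    by simp
  then have lead_g: "lead_monomial g = 0"
    by (simp add: keys_add_nat)
  have "m = 0" if "m \<in> Poly_Mapping.keys g" for m
    using le_lead_monomial[OF that] monomial_nonneg[of m] lead_g by simp
  then have "Poly_Mapping.lookup g m = Poly_Mapping.lookup 1 m" for m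
    using monic[OF g(1)] lead_g
    by (cases "m = 0") (auto simp: lead_coefficient_def lookup_one in_keys_iff)
  then have "g = 1"
    by (rule poly_mapping_eqI)
  have "p = 1" if "p \<in> G" for p
  proof (rule ccontr)
    assume "p \<noteq> 1"
    have "p \<noteq> 0"
      using monic[OF that] by (auto simp: lead_coefficient_eq_0_iff[symmetric])
    define L where "L = Idl\<^bsub>poly_ring W\<^esub> (lead_term ` (G - {p}))"
    have keysW: "Poly_Mapping.keys m \<subseteq> W" if "q \<in> G" "m \<in> Poly_Mapping.keys q" for q m
      using that groebner_basis_subset[OF gb] subset_carrier by (intro keys_subset_vars[of q]) auto
    have "lead_term q \<in> carrier (poly_ring W)" if "q \<in> G" for q
      using keysW[OF that lead_monomial_in_keys] monic[OF that]
      by (cases "q = 0") (auto simp: lead_term_def lead_coefficient_eq_0_iff[symmetric] intro: carrier_intros)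
    then interpret L: poly_ideal W L
      unfolding L_def by (intro poly_ideal_Idl) auto
    have "lead_term 1 \<in> L"
      using g(1) \<open>g = 1\<close> \<open>p \<noteq> 1\<close> Idl_superset[of "lead_term ` (G - {p})" W] by (auto simp: L_def)
    moreover have "lead_term 1 = 1"
      by (simp add: lead_term_def lead_coefficient_def lead_monomial_def)
    ultimately have "1 \<in> L"
      by simp
    moreover have m: "lead_monomial p \<in> Poly_Mapping.keys p"
      using \<open>p \<noteq> 0\<close> by (rule lead_monomial_in_keys)
    ultimately have "Poly_Mapping.single (lead_monomial p) 1 * 1 \<in> L"
      using keysW[OF that m] by (intro L.mult_mem carrier_intros)
    with G that m show False
      by (auto simp: reduced_groebner_basis_def L_def)
  qed
  with g(1) \<open>g = 1\<close> show ?thesis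
    by auto
qed

section \<open>The program ideal\<close>

text \<open>The point \<open>(f(x), x)\<close>. It is not made \<open>undefined\<close> outside the
  program's variables, so it must be restricted to become a member of \<open>zeros\<close>.\<close>

definition graph_point :: "(nat \<Rightarrow> mpoly) \<Rightarrow> (var \<Rightarrow> real) \<Rightarrow> var \<Rightarrow> real" where
  "graph_point f x v = (case v of Yv i \<Rightarrow> eval x (f i) | Xv j \<Rightarrow> x v)"

lemma graph_point_simps [simp]:
  "graph_point f x (Xv j) = x (Xv j)"
  "graph_point f x (Yv i) = eval x (f i)"
  by (simp_all add: graph_point_def)

lemma Xv_in_xvars [simp]: "Xv j \<in> xvars l n \<longleftrightarrow> l < j \<and> j \<le> n"
  and Yv_in_yvars [simp]: "Yv i \<in> yvars l k \<longleftrightarrow> l < i \<and> i \<le> k"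
  and Yv_notin_xvars [simp]: "Yv i \<notin> xvars l n"
  and Xv_notin_yvars [simp]: "Xv j \<notin> yvars l k"
  by (auto simp: xvars_def yvars_def)

lemma xvars_Suc_subset: "xvars (Suc l) n \<subseteq> xvars l n"
  by (auto simp: xvars_def)

lemma finite_xvars: "finite (xvars l n)" and finite_yvars: "finite (yvars l k)"
  by (simp_all add: xvars_def yvars_def)

lemma eval_graph_point:
  "p \<in> carrier (poly_ring (xvars l n)) \<Longrightarrow> eval (graph_point f x) p = eval x p"
  by (erule eval_cong) (auto simp: xvars_def)

lemma graph_point_yvars: "v \<in> yvars 0 k \<Longrightarrow> graph_point f x v = objective k f x v"
  by (auto simp: objective_def yvars_def)

lemma objective_in_PiE: "objective k f x \<in> yvars 0 k \<rightarrow>\<^sub>E UNIV"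
  by (simp add: objective_def)

lemma objective_Yv: "i \<in> {1..k} \<Longrightarrow> objective k f x (Yv i) = eval x (f i)"
  by (simp add: objective_def)

locale program =
  fixes k n s :: nat and f h :: "nat \<Rightarrow> mpoly"
  assumes objectives: "\<And>i. i \<in> {1..k} \<Longrightarrow> f i \<in> carrier (poly_ring (xvars 0 n))"
    and constraints: "\<And>r. r \<in> {1..s} \<Longrightarrow> h r \<in> carrier (poly_ring (xvars 0 n))"
begin

abbreviation vars :: "var set" where "vars \<equiv> yvars 0 k \<union> xvars 0 n"

abbreviation I :: "mpoly set" where "I \<equiv> program_ideal k n s f h"

definition generators :: "mpoly set" where
  "generators = (\<lambda>i. f i - PVar (Yv i)) ` {1..k} \<union> h ` {1..s} \<union>
     (\<lambda>j. PVar (Xv j) * (PVar (Xv j) - 1)) ` {1..n}"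

lemma carrier_x_vars: "p \<in> carrier (poly_ring (xvars 0 n)) \<Longrightarrow> p \<in> carrier (poly_ring vars)"
  using carrier_poly_ring_mono[of "xvars 0 n" vars] by blast

lemma generators_carrier: "generators \<subseteq> carrier (poly_ring vars)"
  unfolding generators_def
  by (auto intro!: carrier_diff carrier_mult carrier_1 carrier_PVar
      objectives[THEN carrier_x_vars] constraints[THEN carrier_x_vars])

lemma program_ideal_eq: "I = Idl\<^bsub>poly_ring vars\<^esub> generators"
  by (simp add: program_ideal_def generators_def)

sublocale poly_ideal vars I
  unfolding program_ideal_eq using generators_carrier by (rule poly_ideal_Idl)

lemma generators_mem: "generators \<subseteq> I"
  unfolding program_ideal_eq by (rule Idl_superset)

lemma eval_program_ideal:
  assumes "feasible n s h x" "p \<in> I"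
  shows "eval (graph_point f x) p = 0"
proof (rule eval_Idl_eq_0[OF generators_carrier])
  show "p \<in> Idl\<^bsub>poly_ring vars\<^esub> generators"
    using assms(2) by (simp add: program_ideal_eq)
  fix g assume "g \<in> generators"
  then consider i where "i \<in> {1..k}" "g = f i - PVar (Yv i)"
    | r where "r \<in> {1..s}" "g = h r"
    | j where "j \<in> {1..n}" "g = PVar (Xv j) * (PVar (Xv j) - 1)"
    by (auto simp: generators_def)
  then show "eval (graph_point f x) g = 0"
  proof cases
    case 1
    then show ?thesis
      by (simp add: eval_simps eval_graph_point[OF objectives])
  next
    case 2
    then show ?thesis
      using assms(1) by (simp add: eval_graph_point[OF constraints] feasible_def)
  next
    case 3
    then have "x (Xv j) \<in> {0, 1}"
      using assms(1) by (auto simp: feasible_def intro!: PiE_mem[of x])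
    with 3 show ?thesis
      by (auto simp: eval_simps)
  qed
qed

section \<open>Lagrange interpolation on the vertices of the binary cube\<close>

definition indicator_poly :: "nat set \<Rightarrow> mpoly" where
  "indicator_poly A = (\<Prod>j\<in>A. PVar (Xv j)) * (\<Prod>j\<in>{1..n} - A. 1 - PVar (Xv j))"

definition indicator_point :: "nat set \<Rightarrow> var \<Rightarrow> real" where
  "indicator_point A = (\<lambda>v\<in>xvars 0 n. if v \<in> Xv ` A then 1 else 0)"

text \<open>A partition of unity, obtained by expanding the product over \<open>j\<close> of the
  sums \<open>PVar (Xv j) + (1 - PVar (Xv j))\<close>.\<close>

lemma sum_indicator_poly: "(\<Sum>A\<in>Pow {1..n}. indicator_poly A) = 1"
  using prod_add[of "{1..n}" "\<lambda>j. PVar (Xv j)" "\<lambda>j. 1 - PVar (Xv j)"]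
  by (simp add: indicator_poly_def)

lemma indicator_poly_carrier: "A \<subseteq> {1..n} \<Longrightarrow> indicator_poly A \<in> carrier (poly_ring vars)"
  unfolding indicator_poly_def by (intro carrier_intros carrier_prod) auto

text \<open>The factor that \<open>j\<close> contributes to \<open>indicator_poly A\<close> is, up
  to sign, complementary to the factor in front, so the product is a multiple of the generator
  \<open>PVar (Xv j) * (PVar (Xv j) - 1)\<close>.\<close>

lemma binary_mult_indicator_mem:
  assumes "A \<subseteq> {1..n}" "j \<in> {1..n}"
  shows "(PVar (Xv j) - Poly_Mapping.single 0 (indicator_point A (Xv j))) * indicator_poly A \<in> I"
proof -
  define x where "x = PVar (Xv j)"
  have x: "x \<in> carrier (poly_ring vars)"
    using assms(2) by (auto simp: x_def intro!: carrier_intros)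
  have mem: "x * (x - 1) \<in> I"
    unfolding x_def using generators_mem assms(2) by (auto simp: generators_def)
  show ?thesis
  proof (cases "j \<in> A")
    case True
    define r where "r = (\<Prod>j\<in>A - {j}. PVar (Xv j)) * (\<Prod>j\<in>{1..n} - A. 1 - PVar (Xv j))"
    have "indicator_poly A = x * r"
      using True finite_subset[OF assms(1)]
      by (simp add: indicator_poly_def r_def x_def prod.remove mult.assoc)
    moreover have "r \<in> carrier (poly_ring vars)"
      unfolding r_def using assms(1) by (intro carrier_intros carrier_prod) auto
    ultimately show ?thesis
      using True assms(2) mult_mem[OF _ mem, of r] by (simp add: indicator_point_def x_def mult_ac)
  next
    case False
    define r where "r = (\<Prod>j\<in>A. PVar (Xv j)) * (\<Prod>j\<in>{1..n} - A - {j}. 1 - PVar (Xv j))"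
    have eq: "indicator_poly A = (1 - x) * r"
      using False assms(2) prod.remove[of "{1..n} - A" j "\<lambda>j. 1 - PVar (Xv j)"]
      by (simp add: indicator_poly_def r_def x_def mult_ac)
    have "x * indicator_poly A = - r * (x * (x - 1))"
      unfolding eq by (simp add: algebra_simps)
    moreover have "- r \<in> carrier (poly_ring vars)"
      unfolding r_def using assms(1) by (intro carrier_intros carrier_prod) auto
    ultimately show ?thesis
      using False assms(2) mult_mem[OF _ mem, of "- r"]
      by (auto simp: indicator_point_def x_def image_iff)
  qed
qed

text \<open>Multiplying by \<^term>\<open>indicator_poly A\<close> amounts, modulo the ideal, to evaluating at the point
  over \<^term>\<open>indicator_point A\<close>.\<close>

lemma mult_indicator_mem:
  assumes A: "A \<subseteq> {1..n}" and p: "p \<in> carrier (poly_ring vars)"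
  shows "(p - Poly_Mapping.single 0 (eval (graph_point f (indicator_point A)) p)) * indicator_poly A \<in> I"
proof -
  let ?a = "graph_point f (indicator_point A)" and ?d = "indicator_poly A"
  define E where "E p \<longleftrightarrow> (p - Poly_Mapping.single 0 (eval ?a p)) * ?d \<in> I" for p
  have single_mult: "Poly_Mapping.single 0 (b * c) = Poly_Mapping.single 0 b * (Poly_Mapping.single 0 c :: mpoly)"
    for b c
    by (simp add: mult_single)
  have const: "E (Poly_Mapping.single 0 c)" for c
    by (simp add: E_def eval_simps zero_mem)
  have add: "E (p + q)" if "E p" "E q" for p q
  proof -
    have "(p + q - Poly_Mapping.single 0 (eval ?a (p + q))) * ?d =
        (p - Poly_Mapping.single 0 (eval ?a p)) * ?d + (q - Poly_Mapping.single 0 (eval ?a q)) * ?d"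
      by (simp add: eval_simps single_add algebra_simps)
    with that show ?thesis
      by (simp add: E_def add_mem)
  qed
  have mult: "E (p * q)" if "p \<in> carrier (poly_ring vars)" "E p" "E q" for p q
  proof -
    have "(p * q - Poly_Mapping.single 0 (eval ?a (p * q))) * ?d =
        p * ((q - Poly_Mapping.single 0 (eval ?a q)) * ?d) +
        Poly_Mapping.single 0 (eval ?a q) * ((p - Poly_Mapping.single 0 (eval ?a p)) * ?d)"
      by (simp add: eval_simps single_mult algebra_simps)
    with that show ?thesis
      by (simp add: E_def add_mem mult_mem carrier_single)
  qed
  have var_x: "E (PVar v)" if "v \<in> xvars 0 n" for v
    using that binary_mult_indicator_mem[OF A] by (auto simp: E_def eval_simps xvars_def)
  \<comment> \<open>Polynomials in the x-variables come first, because a variable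
    \<open>Yv i\<close> is congruent to \<open>f i\<close> modulo \<open>I\<close> and is reduced to
    this case.\<close>
  have E_x: "E p" if "p \<in> carrier (poly_ring (xvars 0 n))" for p
    using that
    by (induction p rule: poly_ring_induct) (auto intro: const var_x add mult carrier_x_vars)
  have var_y: "E (PVar v)" if v: "v \<in> yvars 0 k" for v
  proof -
    obtain i where i: "i \<in> {1..k}" "v = Yv i"
      using v by (auto simp: yvars_def)
    have mem: "f i - PVar v \<in> I"
      using generators_mem i by (auto simp: generators_def)
    have "(f i - Poly_Mapping.single 0 (eval ?a (f i))) * ?d - ?d * (f i - PVar v) \<in> I"
      using E_x[OF objectives[OF i(1)]]
      by (intro diff_mem[OF _ mult_mem[OF indicator_poly_carrier[OF A] mem]]) (simp add: E_def)
    moreover have "eval ?a (PVar v) = eval ?a (f i)"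
      by (simp add: eval_simps i(2) eval_graph_point[OF objectives[OF i(1)]])
    ultimately show ?thesis
      by (simp add: E_def algebra_simps)
  qed
  have "E p"
    using p by (induction p rule: poly_ring_induct) (auto intro: const var_x var_y add mult)
  then show ?thesis
    by (simp add: E_def)
qed

text \<open>A Nullstellensatz for \<open>I\<close>. By the partition of unity it suffices to treat
  \<open>p * indicator_poly A\<close> vertex by vertex: at a feasible vertex \<open>p\<close> has
  value zero, and at an infeasible one the indicator itself is in \<open>I\<close>.\<close>

lemma program_ideal_radical:
  assumes p: "p \<in> carrier (poly_ring vars)"
    and zero: "\<And>x. feasible n s h x \<Longrightarrow> eval (graph_point f x) p = 0"
  shows "p \<in> I"
proof -
  have "p * indicator_poly A \<in> I" if A: "A \<subseteq> {1..n}" for A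
  proof (cases "feasible n s h (indicator_point A)")
    case True
    with mult_indicator_mem[OF A p] zero show ?thesis
      by simp
  next
    case False
    moreover have "indicator_point A \<in> xvars 0 n \<rightarrow>\<^sub>E {0, 1}"
      by (auto simp: indicator_point_def)
    ultimately obtain r where r: "r \<in> {1..s}" "eval (indicator_point A) (h r) \<noteq> 0"
      by (auto simp: feasible_def)
    define c where "c = eval (indicator_point A) (h r)"
    have d: "indicator_poly A \<in> carrier (poly_ring vars)"
      by (rule indicator_poly_carrier[OF A])
    have "h r \<in> I"
      using generators_mem r(1) by (auto simp: generators_def)
    \<comment> \<open>Modulo \<open>I\<close>, the product of \<open>h r\<close> and the indicator
      is both zero and \<open>c\<close> times the indicator. As \<open>c\<close> is nonzero, it can
      be divided out.\<close>
    then have "indicator_poly A * h r - (h r - Poly_Mapping.single 0 c) * indicator_poly A \<in> I"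
      using mult_indicator_mem[OF A carrier_x_vars[OF constraints[OF r(1)]]]
      by (intro diff_mem mult_mem[OF d]) (simp_all add: c_def eval_graph_point[OF constraints[OF r(1)]])
    then have "Poly_Mapping.single 0 c * indicator_poly A \<in> I"
      by (simp add: algebra_simps)
    then have mem: "(p * Poly_Mapping.single 0 (1 / c)) * (Poly_Mapping.single 0 c * indicator_poly A) \<in> I"
      by (intro mult_mem[OF carrier_mult[OF p carrier_single]]) auto
    have "(p * Poly_Mapping.single 0 (1 / c)) * (Poly_Mapping.single 0 c * indicator_poly A) =
        p * (Poly_Mapping.single 0 (1 / c) * Poly_Mapping.single 0 c) * indicator_poly A"
      by (simp only: mult_ac)
    also have "Poly_Mapping.single 0 (1 / c) * Poly_Mapping.single 0 c = (1 :: mpoly)"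
      using r(2) by (simp add: mult_single c_def)
    finally show ?thesis
      using mem by (simp only: mult_1_right)
  qed
  then have "(\<Sum>A\<in>Pow {1..n}. p * indicator_poly A) \<in> I"
    by (intro sum_mem) auto
  then show ?thesis
    by (simp only: sum_distrib_left[symmetric] sum_indicator_poly mult_1_right)
qed

text \<open>The polynomial \<open>1\<close> vanishes at all graph points over feasible points only
  when there are none.\<close>

lemma one_mem_iff_infeasible: "1 \<in> I \<longleftrightarrow> \<not> (\<exists>x. feasible n s h x)"
  using eval_program_ideal[of _ 1] program_ideal_radical[OF carrier_1]
  by (auto simp: eval_simps)

lemma finite_feasible: "finite {x. feasible n s h x}"
  by (rule finite_subset[of _ "xvars 0 n \<rightarrow>\<^sub>E {0, 1}"])
     (auto simp: feasible_def intro!: finite_PiE finite_xvars)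

end

section \<open>Correctness of the algorithm\<close>

lemma sweep_eq_last:
  assumes "\<And>l b. Suc l < N \<Longrightarrow> b \<in> C l \<Longrightarrow> restrict b (W (Suc l)) \<in> C (Suc l)"
    and "0 < j" "j \<le> N"
  shows "sweep W C N j = C (N - j)"
  using assms(2,3)
proof (induction j)
  case (Suc j)
  show ?case
  proof (cases "j = 0")
    case True
    \<comment> \<open>The starting set contains every restriction to \<open>W N\<close>, so the
      first extension is constrained by \<open>C (N - 1)\<close> alone.\<close>
    have "sweep W C N (Suc 0) = {b \<in> C (N - 1). restrict b (W N) \<in> W N \<rightarrow>\<^sub>E UNIV}"
      by auto
    also have "\<dots> = C (N - 1)"
      by (auto simp: PiE_def extensional_def)
    finally show ?thesis
      using True by simp
  next
    case False
    then have "sweep W C N j = C (N - j)" and l: "Suc (N - Suc j) = N - j" "Suc (N - Suc j) < N"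
      using Suc by auto
    then have "sweep W C N (Suc j) = {b \<in> C (N - Suc j). restrict b (W (N - j)) \<in> C (N - j)}"
      by auto
    with assms(1)[OF l(2)] show ?thesis
      unfolding l(1) by blast
  qed
qed simp

text \<open>Fewer variables leave fewer polynomials of \<open>G\<close>, and these see only the
  coordinates that are kept.\<close>

lemma zeros_restrict:
  assumes "a \<in> zeros W (G \<inter> carrier (poly_ring W))" "W' \<subseteq> W"
  shows "restrict a W' \<in> zeros W' (G \<inter> carrier (poly_ring W'))"
proof -
  have "eval (restrict a W') g = 0" if "g \<in> G" "g \<in> carrier (poly_ring W')" for g
  proof -
    have "eval (restrict a W') g = eval a g"
      using that(2) by (rule eval_cong) simp
    also have "\<dots> = 0"
      using assms(1) that carrier_poly_ring_mono[OF assms(2)] by (auto simp: zeros_def)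
    finally show ?thesis .
  qed
  then show ?thesis
    by (simp add: zeros_def)
qed

locale groebner_program = program +
  fixes G :: "mpoly set"
  assumes reduced: "reduced_groebner_basis vars I G"
begin

lemma groebner: "groebner_basis vars I G"
  using reduced by (simp add: reduced_groebner_basis_def)

lemma G_subset: "G \<subseteq> I"
  using groebner by (simp add: groebner_basis_def)

lemma eq_one_iff_infeasible: "G = {1} \<longleftrightarrow> \<not> (\<exists>x. feasible n s h x)"
proof
  assume "G = {1}"
  with G_subset have "1 \<in> I"
    by simp
  then show "\<not> (\<exists>x. feasible n s h x)"
    by (rule one_mem_iff_infeasible[THEN iffD1])
next
  assume "\<not> (\<exists>x. feasible n s h x)"
  then show "G = {1}"
    using reduced_groebner_basis_eq_one[OF poly_ideal_axioms reduced]
    by (simp add: one_mem_iff_infeasible)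
qed

text \<open>Elimination gives the exact image, with no closure to take, because a finite set of
  values is separated from any other point by a product of linear factors.\<close>

lemma elimination_zeros:
  "zeros (yvars 0 k) (G \<inter> carrier (poly_ring (yvars 0 k))) = objective k f ` {x. feasible n s h x}"
  (is "?Z = ?Y")
proof (intro equalityI subsetI)
  fix y assume y: "y \<in> ?Z"
  show "y \<in> ?Y"
  proof (rule ccontr)
    assume "y \<notin> ?Y"
    have "\<exists>v\<in>yvars 0 k. y v \<noteq> z v" if "z \<in> ?Y" for z
    proof (rule ccontr)
      assume "\<not> ?thesis"
      moreover have "z \<in> yvars 0 k \<rightarrow>\<^sub>E UNIV" "y \<in> yvars 0 k \<rightarrow>\<^sub>E UNIV"
        using that y objective_in_PiE by (auto simp: zeros_def)
      ultimately have "y = z"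
        by (intro PiE_ext) auto
      with that \<open>y \<notin> ?Y\<close> show False
        by simp
    qed
    then obtain v where v: "\<And>z. z \<in> ?Y \<Longrightarrow> v z \<in> yvars 0 k" "\<And>z. z \<in> ?Y \<Longrightarrow> y (v z) \<noteq> z (v z)"
      by metis
    have fin: "finite ?Y"
      using finite_feasible by simp
    \<comment> \<open>Here \<open>v z\<close> is a coordinate in which \<open>y\<close> differs from
      the value \<open>z\<close>, so \<open>q\<close> vanishes at every value but not at
      \<open>y\<close>. Finiteness of \<open>?Y\<close> matters, as \<open>prod\<close> over an
      infinite set is \<open>1\<close>.\<close>
    define q where "q = (\<Prod>z\<in>?Y. PVar (v z) - Poly_Mapping.single 0 (z (v z)))"
    have q: "q \<in> carrier (poly_ring (yvars 0 k))"
      unfolding q_def using v(1) by (intro carrier_prod carrier_intros) auto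
    have "q \<in> I"
    proof (rule program_ideal_radical)
      show "q \<in> carrier (poly_ring vars)"
        using q carrier_poly_ring_mono[of "yvars 0 k" vars] by blast
      fix x assume "feasible n s h x"
      then have x: "objective k f x \<in> ?Y"
        by simp
      have "eval (graph_point f x) (PVar (v (objective k f x)) -
          Poly_Mapping.single 0 (objective k f x (v (objective k f x)))) = 0"
        by (simp add: eval_simps graph_point_yvars[OF v(1)[OF x]])
      with fin x show "eval (graph_point f x) q = 0"
        unfolding q_def eval_prod prod_zero_iff[OF fin] by blast
    qed
    have "eval y q = 0"
    proof (rule groebner_elimination_zero[OF poly_ideal_axioms groebner finite_yvars])
      show "w \<in> yvars 0 k" if "v \<in> yvars 0 k" "w \<in> vars" "v < w" for v w
        using that by (auto simp: yvars_def xvars_def)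
      show "eval y g = 0" if "g \<in> G" "g \<in> carrier (poly_ring (yvars 0 k))" for g
        using y that by (simp add: zeros_def)
    qed (use q \<open>q \<in> I\<close> in simp_all)
    then show False
      unfolding q_def eval_prod prod_zero_iff[OF fin] using v(2) by (auto simp: eval_simps)
  qed
next
  fix y assume "y \<in> ?Y"
  then obtain x where x: "feasible n s h x" "y = objective k f x"
    by auto
  have "eval y g = 0" if "g \<in> G" "g \<in> carrier (poly_ring (yvars 0 k))" for g
  proof -
    have "eval y g = eval (graph_point f x) g"
      using that(2) by (rule eval_cong) (simp add: x graph_point_yvars)
    also have "\<dots> = 0"
      using eval_program_ideal[OF x(1)] that(1) G_subset by blast
    finally show ?thesis .
  qed
  then show "y \<in> ?Z"
    using x(2) objective_in_PiE by (simp add: zeros_def)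
qed

text \<open>With \<open>U\<close> the set of all variables, division shows that zeros of
  \<open>G\<close> are zeros of \<open>I\<close>; the generators \<open>f i - PVar (Yv i)\<close>
  then determine the y-coordinates from the x-coordinates.\<close>

lemma zeros_eq_graph:
  assumes "a \<in> zeros vars G" "\<And>v. v \<in> xvars 0 n \<Longrightarrow> a v = x v" "v \<in> vars"
  shows "a v = graph_point f x v"
proof -
  have "a (Yv i) = eval x (f i)" if i: "i \<in> {1..k}" for i
  proof -
    have mem: "f i - PVar (Yv i) \<in> I"
      using generators_mem i by (auto simp: generators_def)
    have "eval a (f i - PVar (Yv i)) = 0"
    proof (rule groebner_elimination_zero[OF poly_ideal_axioms groebner, of vars])
      show "eval a g = 0" if "g \<in> G" for g
        using assms(1) that by (simp add: zeros_def)
    qed (use mem subset_carrier in \<open>auto simp: finite_xvars finite_yvars\<close>)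
    moreover have "eval a (f i) = eval x (f i)"
      using objectives[OF i] assms(2) by (rule eval_cong)
    ultimately show ?thesis
      by (simp add: eval_simps)
  qed
  with assms(2,3) show ?thesis
    by (auto simp: xvars_def yvars_def)
qed

section \<open>Steps 2 and 3: attained and efficient objective vectors\<close>

lemma step2_eq:
  assumes "\<exists>x. feasible n s h x"
  shows "step2 k G = objective k f ` {x. feasible n s h x}"
proof (cases "k = 0")
  \<comment> \<open>Without objectives the sweep takes no step and returns the one empty vector; the
    right-hand side agrees only because a feasible point exists.\<close>
  case True
  have "objective 0 f x = (\<lambda>_. undefined)" for x
    by (simp add: objective_def yvars_def restrict_def)
  with True assms show ?thesis
    by (auto simp: step2_def yvars_def)
next
  case False
  have "step2 k G = zeros (yvars (k - k) k) (G \<inter> carrier (poly_ring (yvars (k - k) k)))"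
    unfolding step2_def
    by (rule sweep_eq_last) (use False in \<open>auto intro!: zeros_restrict simp: yvars_def\<close>)
  then show ?thesis
    by (simp add: elimination_zeros)
qed

text \<open>Domination sees points only through their objective vectors, which matches the
  comparison made in Step 3.\<close>

lemma dominated_by_iff:
  "dominated_by k f x x' \<longleftrightarrow>
    (\<forall>i\<in>{1..k}. objective k f x' (Yv i) \<le> objective k f x (Yv i)) \<and> objective k f x' \<noteq> objective k f x"
  by (simp add: dominated_by_def objective_Yv)

lemma step3_eq:
  assumes "\<exists>x. feasible n s h x"
  shows "step3 k G = efficient_set k n s f h"
  unfolding step3_def step2_eq[OF assms] efficient_set_def nondominated_set_def dominated_by_iff
  by blast

text \<open>A feasible point sharing its objective vector with a nondominated one is dominated by
  nothing either. Hence selecting efficient vectors selects exactly the nondominated points above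
  them.\<close>

lemma objective_mem_efficient_iff:
  assumes "feasible n s h x"
  shows "objective k f x \<in> efficient_set k n s f h \<longleftrightarrow> x \<in> nondominated_set k n s f h"
proof
  assume "objective k f x \<in> efficient_set k n s f h"
  then obtain x' where "x' \<in> nondominated_set k n s f h" "objective k f x = objective k f x'"
    by (auto simp: efficient_set_def)
  with assms show "x \<in> nondominated_set k n s f h"
    by (simp add: nondominated_set_def dominated_by_iff)
qed (simp add: efficient_set_def)

section \<open>Step 4: recovering the nondominated points\<close>

lemma step4_admissible_restrict:
  assumes "a \<in> step4_admissible k n s h Y l"
  shows "restrict a (yvars 0 k \<union> xvars (Suc l) n) \<in> step4_admissible k n s h Y (Suc l)"
proof -
  have "\<exists>x. feasible n s h x \<and> (\<forall>v\<in>xvars (Suc l) n. x v = restrict a (yvars 0 k \<union> xvars (Suc l) n) v)"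
    using assms xvars_Suc_subset unfolding step4_admissible_def by fastforce
  moreover have "restrict (restrict a (yvars 0 k \<union> xvars (Suc l) n)) (yvars 0 k) = restrict a (yvars 0 k)"
    by (auto simp: restrict_def)
  ultimately show ?thesis
    using assms by (simp add: step4_admissible_def)
qed

lemma step4_eq_image:
  assumes "\<exists>x. feasible n s h x" "0 < n"
  shows "step4 k n s h G = (\<lambda>a. restrict a (xvars 0 n)) `
    (zeros vars G \<inter> step4_admissible k n s h (efficient_set k n s f h) 0)"
proof -
  let ?W = "\<lambda>l. yvars 0 k \<union> xvars l n"
  let ?C = "\<lambda>l. zeros (?W l) (G \<inter> carrier (poly_ring (?W l))) \<inter>
    step4_admissible k n s h (step3 k G) l"
  have "restrict b (?W (Suc l)) \<in> ?C (Suc l)" if "b \<in> ?C l" for l b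
  proof
    have "?W (Suc l) \<subseteq> ?W l"
      using xvars_Suc_subset by blast
    with that show "restrict b (?W (Suc l)) \<in> zeros (?W (Suc l)) (G \<inter> carrier (poly_ring (?W (Suc l))))"
      by (intro zeros_restrict[of b "?W l"]) auto
  qed (use that step4_admissible_restrict in blast)
  then have "sweep ?W ?C n n = ?C (n - n)"
    using assms(2) by (intro sweep_eq_last) auto
  moreover have "G \<inter> carrier (poly_ring vars) = G"
    using G_subset subset_carrier by blast
  ultimately show ?thesis
    by (simp add: step4_def step3_eq[OF assms(1)])
qed

lemma step4_eq:
  assumes ex: "\<exists>x. feasible n s h x"
  shows "step4 k n s h G = nondominated_set k n s f h"
proof (cases "n = 0")
  \<comment> \<open>Without x-variables the sweep takes no step and returns all y-vectors, efficient
    or not, but they all project to the empty point, the only feasible one.\<close>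
  case True
  have "feasible 0 s h x \<longleftrightarrow> x = (\<lambda>_. undefined)" for x
    using ex True by (auto simp: feasible_def xvars_def)
  then have "nondominated_set k n s f h = {\<lambda>_. undefined}"
    using True by (auto simp: nondominated_set_def dominated_by_def)
  moreover have "yvars 0 k \<rightarrow>\<^sub>E (UNIV :: real set) \<noteq> {}"
    by (simp add: PiE_eq_empty_iff)
  ultimately show ?thesis
    using True by (auto simp: step4_def xvars_def restrict_def image_iff)
next
  case False
  let ?S = "zeros vars G \<inter> step4_admissible k n s h (efficient_set k n s f h) 0"
  have "restrict a (xvars 0 n) \<in> nondominated_set k n s f h" if a: "a \<in> ?S" for a
  proof -
    obtain x where x: "feasible n s h x" "\<forall>v\<in>xvars 0 n. x v = a v"
      using a by (auto simp: step4_admissible_def)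
    \<comment> \<open>The feasible witness \<open>x\<close> from admissibility agrees with
      \<open>a\<close> on the x-variables, so the y-part of \<open>a\<close>, an efficient vector,
      is the objective vector of \<open>x\<close>.\<close>
    have point: "a v = graph_point f x v" if "v \<in> vars" for v
      by (rule zeros_eq_graph) (use a x(2) that in auto)
    have "restrict a (yvars 0 k) = restrict (objective k f x) (yvars 0 k)"
      by (rule restrict_ext) (simp add: point graph_point_yvars)
    also have "\<dots> = objective k f x"
      by (simp add: objective_def)
    finally have "objective k f x \<in> efficient_set k n s f h"
      using a by (auto simp: step4_admissible_def)
    moreover have "restrict a (xvars 0 n) = x"
    proof -
      have "x \<in> extensional (xvars 0 n)"
        using x(1) by (auto simp: feasible_def PiE_def)
      then show ?thesis
        using x(2) by (metis extensional_restrict restrict_ext)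
    qed
    ultimately show ?thesis
      using objective_mem_efficient_iff[OF x(1)] by simp
  qed
  moreover have "\<exists>a\<in>?S. restrict a (xvars 0 n) = x" if x: "x \<in> nondominated_set k n s f h" for x
  proof -
    have feas: "feasible n s h x"
      using x by (simp add: nondominated_set_def)
    \<comment> \<open>Conversely, the graph point over \<open>x\<close> is the preimage, restricted
      because \<open>zeros\<close> demands \<open>undefined\<close> outside
      \<open>vars\<close>.\<close>
    define a where "a = restrict (graph_point f x) vars"
    have "eval a g = 0" if "g \<in> G" for g
    proof -
      have "g \<in> I"
        using that G_subset by blast
      then have "eval a g = eval (graph_point f x) g"
        using subset_carrier by (intro eval_cong[of g vars]) (auto simp: a_def)
      with eval_program_ideal[OF feas \<open>g \<in> I\<close>] show ?thesis
        by simp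
    qed
    then have "a \<in> zeros vars G"
      by (simp add: zeros_def a_def)
    moreover have "a \<in> step4_admissible k n s h (efficient_set k n s f h) 0"
    proof -
      have "restrict a (yvars 0 k) = restrict (objective k f x) (yvars 0 k)"
        by (rule restrict_ext) (simp add: a_def graph_point_yvars)
      then have "restrict a (yvars 0 k) = objective k f x"
        by (simp add: objective_def)
      moreover have "\<forall>v\<in>xvars 0 n. x v = a v"
        by (auto simp: a_def xvars_def)
      moreover have "a \<in> vars \<rightarrow>\<^sub>E UNIV"
        by (simp add: a_def)
      ultimately show ?thesis
        using x feas objective_mem_efficient_iff[OF feas] by (auto simp: step4_admissible_def)
    qed
    moreover have "restrict a (xvars 0 n) = x"
    proof -
      have "restrict a (xvars 0 n) = restrict x (xvars 0 n)"
        by (rule restrict_ext) (auto simp: a_def xvars_def)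
      also have "\<dots> = x"
        using feas by (simp add: feasible_def PiE_def extensional_restrict)
      finally show ?thesis .
    qed
    ultimately show ?thesis
      by blast
  qed
  ultimately show ?thesis
    unfolding step4_eq_image[OF ex False[unfolded neq0_conv]]
    by (intro equalityI subsetI) (blast, metis image_eqI)
qed

end

theorem theorem3p1:
  fixes k n s :: nat
    and f h :: "nat \<Rightarrow> mpoly"
    and G :: "mpoly set"
  assumes "\<forall>i\<in>{1..k}. f i \<in> carrier (poly_ring (xvars 0 n))"
    and "\<forall>r\<in>{1..s}. h r \<in> carrier (poly_ring (xvars 0 n))"
    and "reduced_groebner_basis (yvars 0 k \<union> xvars 0 n) (program_ideal k n s f h) G"
  shows "(G \<noteq> {1} \<longrightarrow>
            step3 k G = efficient_set k n s f h \<and>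
            step4 k n s h G = nondominated_set k n s f h) \<and>
         (G = {1} \<longrightarrow> \<not> (\<exists>x. feasible n s h x))"
proof -
  interpret groebner_program k n s f h G
    by unfold_locales (use assms in auto)
  \<comment> \<open>When \<open>G \<noteq> {1}\<close>, the equivalence supplies the feasible point
    that \<open>step3_eq\<close> and \<open>step4_eq\<close> assume.\<close>
  show ?thesis
    using eq_one_iff_infeasible step3_eq step4_eq by blast
qed

end
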